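(* Let $s>1$ be an integer. The functions $\varphi_{m,n}(z)$, for $m=0,1,\ldots,2s-1$ and $n=2s-m-1$ (the Padé iterations and the reciprocal Padé iterations with $m+n=2s-1$, see context), define the unique rational iterations of the kind $z_{k+1}=\varphi(z_k)$ such that both of the following hold: (O1) the iteration $z_{k+1}=\varphi(z_k)$ converges locally to $1$ and to $-1$ with order at least $s$; (O2) for every iteration $w_{k+1}=\widetilde\varphi(w_k)=\widetilde a(w_k)/\widetilde b(w_k)$, with $\widetilde a(z),\widetilde b(z)$ polynomials, having order at least $s$ at both $1$ and $-1$, it holds that $\deg(\widetilde a(z))+\deg(\widetilde b(z))\geq \deg(a(z))+\deg(b(z))$, where $a(z)$ and $b(z)$ are coprime polynomials such that $\varphi(z)=a(z)/b(z)$. That is, a rational function $\varphi$ satisfies (O1) and (O2) if and only if $\varphi=\varphi_{m,n}$ for some $m\in\{0,1,\ldots,2s-1\}$ and $n=2s-m-1$. Moreover, each of the iterations $z_{k+1}=\varphi_{m,n}(z_k)$ with $m\in\{0,1,\ldots,2s-1\}$, $n=2s-m-1$, has order exactly $s$ at both $1$ and $-1$.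
   Context: Polynomials and rational functions are in one complex variable. Padé approximants. For integers $\mu,\nu\ge 0$, the $(\mu,\nu)$ Padé approximant to a function $h(\xi)$ analytic at $0$ is a rational function $p(\xi)/q(\xi)$, where $p$ and $q$ are polynomials of degree $\mu$ and $\nu$, respectively, such that $h(\xi)-p(\xi)/q(\xi)=O(\xi^{\mu+\nu+1})$ as $\xi\to 0$. Let $P_{\mu,\nu}(\xi)/Q_{\mu,\nu}(\xi)$ denote the $(\mu,\nu)$ Padé approximant to $f(\xi)=(1-\xi)^{-1/2}$ (principal branch near $\xi=0$), with $\deg P_{\mu,\nu}=\mu$, $\deg Q_{\mu,\nu}=\nu$. The functions $\varphi_{m,n}$. For integers $\mu,\nu\ge 0$ with $\mu+\nu\ge 1$ define $$\varphi_{2\mu+1,2\nu}(z)=\frac{z\,P_{\mu,\nu}(1-z^2)}{Q_{\mu,\nu}(1-z^2)},\qquad \varphi_{2\mu,2\nu+1}(z)=\frac{Q_{\nu,\mu}(1-z^2)}{z\,P_{\nu,\mu}(1-z^2)}.$$ The iterations given by the first family are the Padé iterations, those given by the second are the reciprocal Padé iterations. (Equivalently, $Q_{\nu,\mu}/P_{\nu,\mu}$ is the $(\mu,\nu)$ Padé approximant to $(1-\xi)^{1/2}$.) If $m,n\ge 0$ and $m+n=2s-1$ with $s>1$, then $m$ and $n$ have opposite parity and exactly one of these formulas defines $\varphi_{m,n}$. Order of convergence. Let $\varphi$ be a rational function, $z_*$ a point with $\varphi(z_* )=z_*$ (in particular $\varphi$ is finite at $z_*$), and $s>1$ an integer. The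 iteration $z_{k+1}=\varphi(z_k)$ converges locally to $z_*$ with order (exactly) $s$ if there are $M_1,M_2>0$ such that $M_1|z-z_*|^s\le|\varphi(z)-z_*|\le M_2|z-z_*|^s$ for all $z$ sufficiently close to $z_*$; equivalently, $\varphi(z_* )=z_*$, $\varphi'(z_* )=\cdots=\varphi^{(s-1)}(z_* )=0$ and $\varphi^{(s)}(z_* )\ne 0$. It has order at least $s$ at $z_*$ if $\varphi(z)-z_*=O((z-z_* )^s)$ as $z\to z_*$; equivalently, $\varphi(z_* )=z_*$ and $\varphi'(z_* )=\cdots=\varphi^{(s-1)}(z_* )=0$. *)

theory Defs
  imports "HOL-Complex_Analysis.Complex_Analysis" "HOL-Computational_Algebra.Field_as_Ring"
    "HOL-Computational_Algebra.Polynomial_Factorial" "HOL-Computational_Algebra.Normalized_Fraction"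
begin

section \<open>Rational functions of one complex variable\<close>

text \<open>
  A rational function is an element of the field of fractions of \<^typ>\<open>complex poly\<close>.
  The function \<^const>\<open>quot_of_fract\<close> yields the reduced numerator and denominator
  (coprime, denominator monic), so common factors never matter.
\<close>

type_synonym ratfun = "complex poly fract"

definition rat_num :: "ratfun \<Rightarrow> complex poly" where
  "rat_num \<phi> = fst (quot_of_fract \<phi>)"

definition rat_den :: "ratfun \<Rightarrow> complex poly" where
  "rat_den \<phi> = snd (quot_of_fract \<phi>)"

definition rat_eval :: "ratfun \<Rightarrow> complex \<Rightarrow> complex" where
  "rat_eval \<phi> z = poly (rat_num \<phi>) z / poly (rat_den \<phi>) z"

text \<open>At a pole \<^const>\<open>rat_eval\<close> is \<open>0\<close>, hence finiteness has to be required separately.\<close>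

definition rat_finite_at :: "ratfun \<Rightarrow> complex \<Rightarrow> bool" where
  "rat_finite_at \<phi> z \<longleftrightarrow> poly (rat_den \<phi>) z \<noteq> 0"

definition rat_fixpoint :: "ratfun \<Rightarrow> complex \<Rightarrow> bool" where
  "rat_fixpoint \<phi> z \<longleftrightarrow> rat_finite_at \<phi> z \<and> rat_eval \<phi> z = z"

lemma rat_eval_Fract:
  assumes "poly b z \<noteq> 0"
  shows "rat_finite_at (Fract a b) z" "rat_eval (Fract a b) z = poly a z / poly b z"
proof -
  let ?\<phi> = "Fract a b"
  have b: "b \<noteq> 0" using assms by auto
  have den: "rat_den ?\<phi> \<noteq> 0"
    unfolding rat_den_def by simp
  have "Fract (rat_num ?\<phi>) (rat_den ?\<phi>) = ?\<phi>"
    unfolding rat_num_def rat_den_def by simp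
  then have eq: "rat_num ?\<phi> * b = a * rat_den ?\<phi>"
    using den b by (simp add: eq_fract)
  have cop: "coprime (rat_num ?\<phi>) (rat_den ?\<phi>)"
    unfolding rat_num_def rat_den_def by (rule coprime_quot_of_fract)
  have eqz: "poly (rat_num ?\<phi>) z * poly b z = poly a z * poly (rat_den ?\<phi>) z"
    using arg_cong[OF eq, of "\<lambda>p. poly p z"] by simp
  show fin: "rat_finite_at ?\<phi> z"
    unfolding rat_finite_at_def
  proof
    assume d0: "poly (rat_den ?\<phi>) z = 0"
    with eqz assms have "poly (rat_num ?\<phi>) z = 0" by simp
    with d0 have "[:-z, 1:] dvd rat_num ?\<phi>" "[:-z, 1:] dvd rat_den ?\<phi>"
      by (simp_all add: poly_eq_0_iff_dvd)
    with cop have "[:-z, 1:] dvd 1" using coprime_common_divisor by blast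
    then show False by (simp add: is_unit_iff_degree)
  qed
  then show "rat_eval ?\<phi> z = poly a z / poly b z"
    using eqz assms unfolding rat_finite_at_def rat_eval_def by (simp add: field_simps)
qed

section \<open>Order of convergence\<close>

definition order_at_least :: "nat \<Rightarrow> ratfun \<Rightarrow> complex \<Rightarrow> bool" where
  "order_at_least s \<phi> z0 \<longleftrightarrow>
     rat_fixpoint \<phi> z0 \<and> (\<lambda>z. rat_eval \<phi> z - z0) \<in> O[at z0](\<lambda>z. (z - z0) ^ s)"

definition order_exactly :: "nat \<Rightarrow> ratfun \<Rightarrow> complex \<Rightarrow> bool" where
  "order_exactly s \<phi> z0 \<longleftrightarrow>
     rat_fixpoint \<phi> z0 \<and>
     (\<exists>M1>0. \<exists>M2>0. \<forall>\<^sub>F z in nhds z0.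
        M1 * cmod (z - z0) ^ s \<le> cmod (rat_eval \<phi> z - z0) \<and>
        cmod (rat_eval \<phi> z - z0) \<le> M2 * cmod (z - z0) ^ s)"

section \<open>Pad\'e approximants\<close>

text \<open>
  The condition is imposed on a punctured neighbourhood of \<open>0\<close>; as \<open>q \<noteq> 0\<close>, the
  denominator has no zeros on a sufficiently small one.
\<close>

definition is_pade_approximant ::
    "(complex \<Rightarrow> complex) \<Rightarrow> nat \<Rightarrow> nat \<Rightarrow> complex poly \<Rightarrow> complex poly \<Rightarrow> bool" where
  "is_pade_approximant h \<mu> \<nu> p q \<longleftrightarrow>
     degree p = \<mu> \<and> degree q = \<nu> \<and> q \<noteq> 0 \<and>
     (\<lambda>\<xi>. h \<xi> - poly p \<xi> / poly q \<xi>) \<in> O[at 0](\<lambda>\<xi>. \<xi> ^ (\<mu> + \<nu> + 1))"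

definition inv_sqrt_fun :: "complex \<Rightarrow> complex" where
  "inv_sqrt_fun \<xi> = (1 - \<xi>) powr (- 1 / 2)"

text \<open>
  The pair of polynomials is determined only up to a common constant factor,
  which cancels in the rational functions below.
\<close>

definition pade_pair :: "nat \<Rightarrow> nat \<Rightarrow> complex poly \<times> complex poly" where
  "pade_pair \<mu> \<nu> = (SOME (p, q). is_pade_approximant inv_sqrt_fun \<mu> \<nu> p q)"

definition pade_P :: "nat \<Rightarrow> nat \<Rightarrow> complex poly" where
  "pade_P \<mu> \<nu> = fst (pade_pair \<mu> \<nu>)"

definition pade_Q :: "nat \<Rightarrow> nat \<Rightarrow> complex poly" where
  "pade_Q \<mu> \<nu> = snd (pade_pair \<mu> \<nu>)"

section \<open>Pad\'e and reciprocal Pad\'e iterations\<close>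

text \<open>Here \<open>[:0, 1:]\<close> is \<open>z\<close> and \<open>[:1, 0, -1:]\<close> is \<open>1 - z\<^sup>2\<close>.\<close>

definition pade_iteration :: "nat \<Rightarrow> nat \<Rightarrow> ratfun" where
  "pade_iteration \<mu> \<nu> =
     Fract ([:0, 1:] * (pade_P \<mu> \<nu> \<circ>\<^sub>p [:1, 0, -1:])) (pade_Q \<mu> \<nu> \<circ>\<^sub>p [:1, 0, -1:])"

definition recip_pade_iteration :: "nat \<Rightarrow> nat \<Rightarrow> ratfun" where
  "recip_pade_iteration \<mu> \<nu> =
     Fract (pade_Q \<nu> \<mu> \<circ>\<^sub>p [:1, 0, -1:]) ([:0, 1:] * (pade_P \<nu> \<mu> \<circ>\<^sub>p [:1, 0, -1:]))"

text \<open>\<open>pade_phi m n\<close> is \<open>\<phi>\<^bsub>m,n\<^esub>\<close>; it is meaningful only for \<open>m\<close>, \<open>n\<close> of opposite parity.\<close>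

definition pade_phi :: "nat \<Rightarrow> nat \<Rightarrow> ratfun" where
  "pade_phi m n =
     (if odd m \<and> even n then pade_iteration (m div 2) (n div 2)
      else if even m \<and> odd n then recip_pade_iteration (m div 2) (n div 2)
      else undefined)"

section \<open>The two characterising properties\<close>

definition locally_convergent_to_signs :: "nat \<Rightarrow> ratfun \<Rightarrow> bool" where
  "locally_convergent_to_signs s \<phi> \<longleftrightarrow> order_at_least s \<phi> 1 \<and> order_at_least s \<phi> (-1)"

text \<open>The competitors \<open>a' / b'\<close> need not be in lowest terms.\<close>

definition minimal_total_degree :: "nat \<Rightarrow> ratfun \<Rightarrow> bool" where
  "minimal_total_degree s \<phi> \<longleftrightarrow>
     (\<exists>a b. b \<noteq> 0 \<and> coprime a b \<and> \<phi> = Fract a b \<and>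
        (\<forall>a' b'. b' \<noteq> 0 \<longrightarrow>
           order_at_least s (Fract a' b') 1 \<longrightarrow> order_at_least s (Fract a' b') (-1) \<longrightarrow>
           degree a' + degree b' \<ge> degree a + degree b))"

end

theory Submission
  imports Defs
begin

text \<open>
  Write \<open>\<phi> = a / b\<close> in lowest terms. Order at least \<open>s\<close> at both \<open>1\<close> and \<open>-1\<close> means that \<open>(z - 1)\<^sup>s\<close> divides
  \<open>a - b\<close> and \<open>(z + 1)\<^sup>s\<close> divides \<open>a + b\<close>. This is a system of \<open>2 s\<close> linear conditions on the pair
  \<open>(a, b)\<close>, called the contact problem below and treated by algebra alone.

  The Wronskian \<open>a' b - a b'\<close> of a coprime solution is nonzero and divisible by
  \<open>(z\<^sup>2 - 1)\<^bsup>s - 1\<^esup>\<close>, while its degree is at most \<open>deg a + deg b - 1\<close>. Hence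
  \<open>deg a + deg b \<ge> 2 s - 1\<close> (\<open>sign_contact_degree_bound\<close>). With \<open>s + 1\<close> in place of \<open>s\<close> at one of the
  points the same argument gives \<open>2 s\<close>, so solutions of total degree \<open>2 s - 1\<close> have order exactly
  \<open>s\<close>. Two nonzero solutions whose degrees are bounded by the same \<open>m\<close> and \<open>n\<close> with
  \<open>m + n = 2 s - 1\<close> represent the same rational function, because their cross difference is a multiple of \<open>(z\<^sup>2 - 1)\<^sup>s\<close> of smaller
  degree (\<open>sign_contact_unique\<close>). For each such \<open>(m, n)\<close> a solution exists and has exactly these
  degrees (\<open>sign_contact_exists\<close>): it is a row of the Euclidean algorithm started at
  \<open>(z\<^sup>2 - 1)\<^sup>s\<close> and the Hermite interpolant, and the degree bound makes every quotient linear. So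
  the least total degree is \<open>2 s - 1\<close>, and the minimisers are indexed by \<open>m = 0, \<dots>, 2 s - 1\<close>.

  It remains to recognise these minimisers. Under \<open>\<xi> = 1 - z\<^sup>2\<close> with \<open>z\<close> near \<open>1\<close> the function
  \<open>(1 - \<xi>)\<^bsup>-1/2\<^esup>\<close> becomes \<open>1 / z\<close>, and \<open>P / Q\<close> is a Pade approximant exactly when
  \<open>z P(1 - z\<^sup>2) - Q(1 - z\<^sup>2)\<close> is divisible by \<open>(z - 1)\<^bsup>\<mu> + \<nu> + 1\<^esup>\<close>, provided that \<open>Q(0) \<noteq> 0\<close> and the
  degrees are right (\<open>pade_imp_dvd\<close>, \<open>dvd_imp_pade\<close>). The condition at \<open>-1\<close> comes for free from the
  symmetry \<open>z \<mapsto> -z\<close>. Conversely, uniqueness makes the solution in degrees \<open>2 \<mu> + 1\<close>, \<open>2 \<nu>\<close> an odd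
  function (\<open>sign_contact_parity\<close>), so it has this form; this also proves that the Pade approximants
  exist. The reciprocal iterations arise by exchanging \<open>a\<close> and \<open>b\<close>, which preserves the contact problem
  since \<open>1 / (\<plusminus>1) = \<plusminus>1\<close>.
\<close>

section \<open>The contact problem: degree bound, normality and uniqueness\<close>

text \<open>
  For \<open>b\<close> nonzero at \<open>\<plusminus>1\<close> this says that \<open>a / b\<close> takes the value \<open>1\<close> at \<open>1\<close> to order \<open>i\<close> and the
  value \<open>-1\<close> at \<open>-1\<close> to order \<open>j\<close>. Divisibility keeps the condition linear in the pair
  \<open>(a, b)\<close> and symmetric in \<open>a\<close> and \<open>b\<close>; the symmetry reflects that \<open>1\<close> and \<open>-1\<close> are their own
  reciprocals, and it is what puts the reciprocal iterations on the same footing.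
\<close>

definition sign_contact :: "nat \<Rightarrow> nat \<Rightarrow> complex poly \<Rightarrow> complex poly \<Rightarrow> bool" where
  "sign_contact i j a b \<longleftrightarrow> [:-1, 1:] ^ i dvd a - b \<and> [:1, 1:] ^ j dvd a + b"

lemma sign_contact_commute: "sign_contact i j a b \<longleftrightarrow> sign_contact i j b a"
  unfolding sign_contact_def by (metis add.commute dvd_minus_iff minus_diff_eq)

lemma coprime_sign_factors: "coprime ([:-1, 1:] ^ i) ([:1, 1 :: complex:] ^ j)"
proof -
  have "is_unit d" if "d dvd [:-1, 1:]" "d dvd [:1, 1 :: complex:]" for d
  proof -
    have "d dvd [:1, 1:] - [:-1, 1:]" using that by (metis dvd_diff)
    then have "d dvd [:2:]" by simp
    then show ?thesis by (metis dvd_trans is_unit_const_poly_iff dvd_field_iff zero_neq_numeral)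
  qed
  then have "coprime [:-1, 1:] [:1, 1 :: complex:]" by (rule coprimeI)
  then show ?thesis by simp
qed

lemma sign_factors_dvd:
  assumes "[:-1, 1:] ^ i dvd p" "[:1, 1 :: complex:] ^ j dvd p"
  shows "[:-1, 1:] ^ i * [:1, 1:] ^ j dvd p"
  using divides_mult[OF assms coprime_sign_factors] .

lemma degree_sign_factors:
  "degree ([:-1, 1:] ^ i * [:1, 1 :: complex:] ^ j) = i + j"
  by (simp add: degree_mult_eq degree_power_eq)

lemma power_dvd_pderiv:
  fixes p q :: "complex poly"
  assumes "q ^ i dvd p"
  shows "q ^ (i - 1) dvd pderiv p"
proof (cases i)
  case (Suc k)
  from assms obtain r where "p = q ^ Suc k * r" unfolding Suc by (elim dvdE)
  then have "pderiv p = q ^ Suc k * pderiv r + r * (smult (of_nat (Suc k)) (q ^ k) * pderiv q)"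
    by (simp only: pderiv_mult pderiv_power_Suc)
  moreover have "q ^ k dvd q ^ Suc k * pderiv r" by simp
  moreover have "q ^ k dvd r * (smult (of_nat (Suc k)) (q ^ k) * pderiv q)"
    by (intro dvd_mult dvd_mult2 dvd_smult dvd_refl)
  ultimately show ?thesis using Suc by (simp del: power_Suc)
qed simp

definition wronskian :: "complex poly \<Rightarrow> complex poly \<Rightarrow> complex poly" where
  "wronskian a b = pderiv a * b - a * pderiv b"

text \<open>
  The Wronskian of \<open>(a, b)\<close> is also that of \<open>(a - b, b)\<close> and of \<open>(a + b, b)\<close>; the first entry
  has a zero of high order at \<open>1\<close>, respectively \<open>-1\<close>, and differentiation lowers that order
  only by one.
\<close>

lemma sign_contact_dvd_wronskian:
  assumes "sign_contact i j a b"
  shows "[:-1, 1:] ^ (i - 1) * [:1, 1:] ^ (j - 1) dvd wronskian a b"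
proof (rule sign_factors_dvd)
  have d: "[:-1, 1:] ^ i dvd a - b" "[:1, 1:] ^ j dvd a + b"
    using assms by (auto simp: sign_contact_def)
  have "[:-1, 1:] ^ (i - 1) dvd pderiv (a - b) * b - (a - b) * pderiv b"
    using power_dvd_pderiv[OF d(1)] dvd_trans[OF le_imp_power_dvd d(1), of "i - 1"]
    by (intro dvd_diff[OF dvd_mult2 dvd_mult2]) auto
  then show "[:-1, 1:] ^ (i - 1) dvd wronskian a b"
    by (simp add: wronskian_def pderiv_diff algebra_simps)
  have "[:1, 1:] ^ (j - 1) dvd pderiv (a + b) * b - (a + b) * pderiv b"
    using power_dvd_pderiv[OF d(2)] dvd_trans[OF le_imp_power_dvd d(2), of "j - 1"]
    by (intro dvd_diff[OF dvd_mult2 dvd_mult2]) auto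
  then show "[:1, 1:] ^ (j - 1) dvd wronskian a b"
    by (simp add: wronskian_def pderiv_add algebra_simps)
qed

lemma degree_wronskian:
  assumes "wronskian a b \<noteq> 0"
  shows "degree (wronskian a b) + 1 \<le> degree a + degree b"
proof (cases "degree a + degree b = 0")
  case True
  then have "pderiv a = 0" "pderiv b = 0" by (auto simp: pderiv_eq_0_iff)
  with assms show ?thesis by (simp add: wronskian_def)
next
  case False
  have *: "degree (pderiv p * q) \<le> degree p + degree q - 1" for p q :: "complex poly"
    by (cases "degree p = 0") (auto simp: degree_pderiv pderiv_eq_0_iff[THEN iffD2]
      intro!: order.trans[OF degree_mult_le])
  have "degree (wronskian a b) \<le> degree a + degree b - 1"
    unfolding wronskian_def
    using *[of a b] *[of b a] by (intro degree_diff_le) (auto simp: mult.commute add.commute)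
  with False show ?thesis by linarith
qed

text \<open>
  If \<open>a' b = a b'\<close> with \<open>a\<close>, \<open>b\<close> coprime, each of them divides its own derivative, which has
  smaller degree.
\<close>

lemma wronskian_eq_0_coprime:
  assumes "coprime a b" "wronskian a b = 0"
  shows "degree a = 0 \<and> degree b = 0"
proof -
  have eq: "pderiv a * b = a * pderiv b" using assms(2) by (simp add: wronskian_def)
  have cst: "degree p = 0" if "p dvd pderiv p" for p :: "complex poly"
    using dvd_imp_degree_le[OF that] pderiv_eq_0_iff[of p] degree_pderiv[of p]
    by (cases "pderiv p = 0") auto
  have "b dvd a * pderiv b" "a dvd pderiv a * b" using eq by (metis dvd_triv_right, metis dvd_triv_left)
  then have "b dvd pderiv b" "a dvd pderiv a"
    using assms(1) by (metis coprime_commute coprime_dvd_mult_right_iff,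
        metis coprime_dvd_mult_left_iff)
  then show ?thesis using cst by blast
qed

text \<open>
  The lower bound on the total degree: the Wronskian has degree less than \<open>deg a + deg b\<close>, but
  it has \<open>(i - 1) + (j - 1)\<close> prescribed zeros. It is not zero because \<open>a / b\<close> takes the distinct
  values \<open>1\<close> and \<open>-1\<close>. Distinct \<open>i\<close> and \<open>j\<close> are needed to exclude an order above \<open>s\<close> at one of the
  two points, and to treat pairs with a common factor.
\<close>

lemma sign_contact_degree_bound:
  assumes "coprime a b" "sign_contact i j a b" "i > 0" "j > 0"
  shows "i + j \<le> degree a + degree b + 1"
proof -
  have "wronskian a b \<noteq> 0"
  proof
    assume "wronskian a b = 0"
    then have deg: "degree a = 0" "degree b = 0" using wronskian_eq_0_coprime assms(1) by auto
    then obtain x y where "a = [:x:]" "b = [:y:]" by (meson degree_eq_zeroE)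
    moreover have "[:-1, 1:] dvd a - b" "[:1, 1:] dvd a + b"
      using assms(2-4) dvd_power[of i "[:-1, 1 :: complex:]"] dvd_power[of j "[:1, 1 :: complex:]"]
      unfolding sign_contact_def by (blast intro: dvd_trans)+
    then have "poly (a - b) 1 = 0" "poly (a + b) (-1) = 0"
      by (simp_all only: poly_eq_0_iff_dvd minus_minus)
    ultimately have "a = 0" "b = 0" by (auto simp: add_eq_0_iff)
    with assms(1) show False by simp
  qed
  note W = this
  have "(i - 1) + (j - 1) \<le> degree (wronskian a b)"
    using dvd_imp_degree_le[OF sign_contact_dvd_wronskian[OF assms(2)] W]
    by (simp only: degree_sign_factors)
  with degree_wronskian[OF W] assms(3,4) show ?thesis by linarith
qed

lemma root_power_dvd_cancel:
  fixes g h :: "complex poly"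
  assumes "[:-c, 1:] ^ n dvd g * h" "g \<noteq> 0"
  shows "[:-c, 1:] ^ (n - order c g) dvd h"
proof (cases "h = 0")
  case False
  then have "n \<le> order c g + order c h"
    using assms by (simp add: order_divides order_mult)
  then show ?thesis using False by (simp add: order_divides)
qed simp

text \<open>
  If one entry vanishes, the other is a multiple of \<open>(z\<^sup>2 - 1)\<^sup>s\<close>.
\<close>

lemma sign_contact_nonzero:
  assumes "sign_contact s s a b" "a \<noteq> 0 \<or> b \<noteq> 0" "degree a + degree b < 2 * s"
  shows "a \<noteq> 0 \<and> b \<noteq> 0"
proof (rule ccontr)
  assume "\<not> ?thesis"
  then obtain c :: "complex poly" where c: "c \<noteq> 0" "degree c \<le> degree a + degree b"
    "[:-1, 1:] ^ s dvd c" "[:1, 1:] ^ s dvd c"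
    using assms(1,2) unfolding sign_contact_def by force
  then show False
    using dvd_imp_degree_le[OF sign_factors_dvd[OF c(3,4)] c(1)] assms(3)
    by (simp only: degree_sign_factors)
qed

text \<open>
  Normality: the nonzero solutions of the contact problem in total degree below \<open>2 s\<close> are automatically
  in lowest terms and have the least possible total degree. Cancelling a common factor \<open>g\<close> costs
  at most \<open>deg g\<close> orders of contact in all, but \<open>2 deg g\<close> of total degree, so the bound
  \<open>sign_contact_degree_bound\<close> for the reduced pair leaves room only for a constant \<open>g\<close>.
\<close>

lemma sign_contact_small_degree:
  assumes "sign_contact s s a b" "a \<noteq> 0 \<or> b \<noteq> 0" "degree a + degree b < 2 * s"
  shows "coprime a b \<and> degree a + degree b + 1 = 2 * s"
proof -
  have nz: "a \<noteq> 0" "b \<noteq> 0" using sign_contact_nonzero assms by auto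
  define g where "g = gcd a b"
  have g: "g \<noteq> 0" using nz by (simp add: g_def)
  obtain a1 b1 where ab: "a = g * a1" "b = g * b1" "coprime a1 b1"
    using gcd_coprime_exists[of a b] g unfolding g_def by (metis mult.commute)
  have nz1: "a1 \<noteq> 0" "b1 \<noteq> 0" using nz ab by auto
  define i j where "i = order 1 g" and "j = order (-1) g"
  have "[:-1, 1:] ^ i * [:1, 1:] ^ j dvd g"
    using order_1[of 1 g] order_1[of "-1" g] unfolding i_def j_def
    by (intro sign_factors_dvd) auto
  then have ij: "i + j \<le> degree g"
    using dvd_imp_degree_le[OF _ g] by (metis degree_sign_factors)
  have deg: "degree a = degree g + degree a1" "degree b = degree g + degree b1"
    using g nz1 by (auto simp: ab degree_mult_eq)
  have small: "i < s" "j < s" using ij deg assms(3) by linarith+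
  have "[:-1, 1:] ^ s dvd g * (a1 - b1)" "[:-(-1), 1:] ^ s dvd g * (a1 + b1)"
    using assms(1) unfolding sign_contact_def by (simp_all add: ab algebra_simps)
  from this[THEN root_power_dvd_cancel, OF g]
  have "sign_contact (s - i) (s - j) a1 b1" by (simp add: sign_contact_def i_def j_def)
  from sign_contact_degree_bound[OF ab(3) this] small
  have "(s - i) + (s - j) \<le> degree a1 + degree b1 + 1" by simp
  then have "degree g = 0" "degree a + degree b + 1 = 2 * s" using deg ij small assms(3) by linarith+
  moreover have "is_unit g" using \<open>degree g = 0\<close> g by (simp add: is_unit_iff_degree)
  then have "coprime a b" by (simp add: g_def coprime_iff_gcd_eq_1 is_unit_gcd_iff)
  ultimately show ?thesis by simp
qed

text \<open>
  The cross difference \<open>a d - b c\<close> is divisible by \<open>(z\<^sup>2 - 1)\<^sup>s\<close> and has degree below \<open>2 s\<close>.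
\<close>

lemma sign_contact_unique:
  assumes "sign_contact s s a b" "sign_contact s s c d"
    and "degree a \<le> m" "degree c \<le> m" "degree b \<le> n" "degree d \<le> n" "m + n < 2 * s"
  shows "a * d = c * b"
proof (rule ccontr)
  assume "a * d \<noteq> c * b"
  then have nz: "a * d - b * c \<noteq> 0" by (simp add: mult.commute)
  have "[:-1, 1:] ^ s dvd (a - b) * d - b * (c - d)" "[:1, 1:] ^ s dvd (a + b) * d - b * (c + d)"
    using assms(1,2) unfolding sign_contact_def by (blast intro: dvd_diff dvd_mult dvd_mult2)+
  then have "[:-1, 1:] ^ s * [:1, 1:] ^ s dvd a * d - b * c"
    by (intro sign_factors_dvd) (simp_all add: algebra_simps)
  from dvd_imp_degree_le[OF this nz] have "2 * s \<le> degree (a * d - b * c)"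
    by (simp only: degree_sign_factors)
  also have "\<dots> \<le> m + n"
    using assms(3-6) degree_mult_le[of a d] degree_mult_le[of b c] by (intro degree_diff_le) auto
  finally show False using assms(7) by simp
qed

section \<open>Existence of solutions by the Euclidean algorithm\<close>

text \<open>
  The polynomial \<open>h\<close> is the Hermite interpolant of the values \<open>\<plusminus>1\<close> at \<open>\<plusminus>1\<close>, obtained from the
  Chinese remainder theorem.
\<close>

lemma sign_contact_exists_polynomial:
  assumes "s > 0"
  obtains h where "sign_contact s s h 1" "degree h < 2 * s"
proof -
  define N where "N = [:-1, 1:] ^ s * [:1, 1 :: complex:] ^ s"
  obtain u v where uv: "u * [:-1, 1:] ^ s + v * [:1, 1 :: complex:] ^ s = 1"
    using bezout_coefficients_fst_snd[of "[:-1, 1:] ^ s" "[:1, 1 :: complex:] ^ s"]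
      coprime_sign_factors[of s s] by (metis coprime_iff_gcd_eq_1)
  define h0 where "h0 = v * [:1, 1:] ^ s - u * [:-1, 1:] ^ s"
  define h where "h = h0 mod N"
  have degN: "degree N = 2 * s" unfolding N_def degree_sign_factors by simp
  have N: "N \<noteq> 0" using degN assms by auto
  have h: "h = h0 - (h0 div N) * N" unfolding h_def by (simp add: minus_div_mult_eq_mod)
  have "h - 1 = [:-1, 1:] ^ s * (- (2 * u) - (h0 div N) * [:1, 1:] ^ s)"
    unfolding h h0_def uv[symmetric] by (simp add: N_def algebra_simps)
  moreover have "h + 1 = [:1, 1:] ^ s * (2 * v - (h0 div N) * [:-1, 1:] ^ s)"
    unfolding h h0_def uv[symmetric] by (simp add: N_def algebra_simps)
  ultimately have "sign_contact s s h 1" by (simp add: sign_contact_def)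
  moreover have "degree h < 2 * s"
    using degree_mod_less'[of N h0] N degN assms unfolding h_def by (metis degree_0 mult_pos_pos zero_less_numeral)
  ultimately show ?thesis using that by blast
qed

lemma sign_contact_diff_mult:
  assumes "sign_contact i j a b" "sign_contact i j c d"
  shows "sign_contact i j (a - q * c) (b - q * d)"
proof -
  have "a - q * c - (b - q * d) = (a - b) - q * (c - d)"
    "a - q * c + (b - q * d) = (a + b) - q * (c + d)" by (simp_all add: algebra_simps)
  then show ?thesis using assms unfolding sign_contact_def by (metis dvd_diff dvd_mult)
qed

text \<open>
  The extended Euclidean algorithm on \<open>(z\<^sup>2 - 1)\<^sup>s\<close> and the Hermite interpolant: the pairs
  \<open>(a, b)\<close> and \<open>(c, d)\<close> are two consecutive rows (remainder, cofactor). Every row solves the contact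
  problem, since the rows are combinations of \<open>((z\<^sup>2 - 1)\<^sup>s, 0)\<close> and \<open>(h, 1)\<close>. By
  \<open>sign_contact_small_degree\<close> no degree is skipped, so all quotients are linear and each way to
  split \<open>2 s - 1\<close> into two degrees occurs.
\<close>

lemma sign_contact_exists_consecutive:
  assumes "n < 2 * s"
  shows "\<exists>a b c d. sign_contact s s a b \<and> sign_contact s s c d \<and>
    degree a = 2 * s - n \<and> (b = 0 \<or> degree b < n) \<and> degree c = 2 * s - 1 - n \<and> degree d = n \<and> d \<noteq> 0"
  using assms
proof (induction n)
  case 0
  then have "s > 0" by simp
  then obtain h where h: "sign_contact s s h 1" "degree h < 2 * s"
    by (rule sign_contact_exists_polynomial)
  then have "degree h + degree (1 :: complex poly) + 1 = 2 * s"
    using sign_contact_small_degree[of s h 1] by simp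
  then have "degree h = 2 * s - 1" by simp
  moreover have "sign_contact s s ([:-1, 1:] ^ s * [:1, 1:] ^ s) 0"
    by (simp add: sign_contact_def)
  moreover have "degree ([:-1, 1:] ^ s * [:1, 1 :: complex:] ^ s) = 2 * s"
    unfolding degree_sign_factors by simp
  ultimately show ?case using h(1) by (metis degree_1 diff_zero one_neq_zero)
next
  case (Suc n)
  then obtain a b c d where IH: "sign_contact s s a b" "sign_contact s s c d"
    "degree a = 2 * s - n" "b = 0 \<or> degree b < n" "degree c = 2 * s - 1 - n" "degree d = n" "d \<noteq> 0"
    by auto
  have c: "c \<noteq> 0" "degree c > 0" using IH(5) Suc.prems by auto
  define q where "q = a div c"
  have r: "a mod c = a - q * c" unfolding q_def by (simp add: minus_div_mult_eq_mod)
  have small: "degree (a mod c) < degree c" using degree_mod_less'[of c a] c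
    by (metis degree_0)
  have "a = q * c + a mod c" using r by simp
  moreover have "degree (a mod c) < degree a" using small IH(3,5) by linarith
  ultimately have "degree (q * c) = degree a"
    using degree_add_eq_left[of "- (a mod c)" a] by (metis add_diff_cancel_right' degree_minus diff_conv_add_uminus)
  moreover have q: "q \<noteq> 0" using calculation IH(3) Suc.prems by auto
  ultimately have "degree q = 1" using IH(3,5) Suc.prems c by (simp add: degree_mult_eq)
  then have "degree (q * d) = n + 1" using IH(6,7) q by (simp add: degree_mult_eq)
  then have d': "degree (b - q * d) = n + 1"
    using IH(4) degree_add_eq_right[of b "- (q * d)"] by auto
  have con: "sign_contact s s (a mod c) (b - q * d)"
    unfolding r by (rule sign_contact_diff_mult) fact+
  \<comment> \<open>Normality forces the next remainder to drop by exactly one degree.\<close>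
  have "b - q * d \<noteq> 0" using d' by auto
  moreover have "degree (a mod c) + degree (b - q * d) < 2 * s"
    using small d' IH(5) Suc.prems by linarith
  ultimately have "degree (a mod c) + degree (b - q * d) + 1 = 2 * s"
    using sign_contact_small_degree[OF con] by blast
  then have "degree (a mod c) = 2 * s - 1 - Suc n" using d' by linarith
  moreover have "degree c = 2 * s - Suc n" using IH(5) by simp
  moreover have "degree d < Suc n" using IH(6) by simp
  ultimately show ?case using IH(2) con d' \<open>b - q * d \<noteq> 0\<close>
    by (metis Suc_eq_plus1)
qed

lemma sign_contact_exists:
  assumes "m + n + 1 = 2 * s"
  obtains a b where "sign_contact s s a b" "degree a = m" "degree b = n" "b \<noteq> 0"
proof -
  have "n < 2 * s" "2 * s - 1 - n = m" using assms by auto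
  then show ?thesis using sign_contact_exists_consecutive[of n s] that by metis
qed

section \<open>Even polynomials\<close>

lemma coeff_pcompose_square:
  fixes p :: "complex poly"
  shows "coeff (p \<circ>\<^sub>p [:0, 0, 1:]) i = (if even i then coeff p (i div 2) else 0)"
proof (induction p arbitrary: i)
  case (pCons a p)
  show ?case
    by (simp add: pcompose_pCons coeff_pCons pCons.IH split: nat.splits)
qed simp

text \<open>
  The argument \<open>1 - z\<^sup>2\<close> instead of \<open>z\<^sup>2\<close> is the substitution that relates the Pade
  approximants at \<open>\<xi> = 0\<close> to the iterations at \<open>z = 1\<close>.
\<close>

lemma even_poly_pcompose:
  assumes "b \<circ>\<^sub>p [:0, -1:] = (b :: complex poly)"
  obtains q where "b = q \<circ>\<^sub>p [:1, 0, -1:]"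
proof -
  have odd0: "coeff b i = 0" if "odd i" for i
  proof -
    have "coeff b i = - coeff b i"
      using that arg_cong[OF assms, of "\<lambda>p. coeff p i"] by (simp add: coeff_pcompose_linear)
    then show ?thesis by simp
  qed
  define r where "r = Poly (map (\<lambda>i. coeff b (2 * i)) [0..<Suc (degree b)])"
  have "coeff r i = coeff b (2 * i)" for i
    by (auto simp: r_def nth_default_def coeff_eq_0 simp del: upt_Suc)
  then have "coeff (r \<circ>\<^sub>p [:0, 0, 1:]) i = coeff b i" for i
    using odd0[of i] by (simp add: coeff_pcompose_square)
  then have "b = r \<circ>\<^sub>p [:0, 0, 1:]" by (simp add: poly_eq_iff)
  also have "\<dots> = (r \<circ>\<^sub>p [:1, -1:]) \<circ>\<^sub>p [:1, 0, -1:]"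
    by (simp add: pcompose_assoc[symmetric] pcompose_pCons)
  finally show ?thesis by (rule that)
qed

section \<open>Order of convergence as divisibility\<close>

lemma tendsto_nonzero_bigtheta_1:
  fixes f :: "'a \<Rightarrow> complex"
  assumes "(f \<longlongrightarrow> l) F" "l \<noteq> 0"
  shows "f \<in> \<Theta>[F](\<lambda>_. 1 :: complex)"
  using assms by (intro bigthetaI_tendsto_norm[of "norm l"]) (auto intro!: tendsto_intros)

lemma poly_tendsto_at: "(poly p \<longlongrightarrow> poly p c) (at (c :: complex))"
  using DERIV_isCont[OF poly_DERIV[of p c]] by (simp add: isCont_def)

lemma poly_bounded_at: "poly p \<in> O[at (c :: complex)](\<lambda>_. 1 :: complex)"
  by (rule bigoI_tendsto[of _ _ "poly p c"]) (simp_all add: poly_tendsto_at)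

text \<open>
  If \<open>p\<close> vanishes at \<open>c\<close> only to order \<open>k < s\<close>, then dividing the estimate by \<open>(z - c)\<^sup>k\<close> forces the
  nonzero cofactor of \<open>p\<close> to tend to \<open>0\<close>.
\<close>

lemma poly_bigo_iff_dvd:
  fixes p :: "complex poly"
  shows "poly p \<in> O[at c](\<lambda>z. (z - c) ^ s) \<longleftrightarrow> [:-c, 1:] ^ s dvd p"
proof
  assume "[:-c, 1:] ^ s dvd p"
  then obtain q where p: "p = [:-c, 1:] ^ s * q" by (elim dvdE)
  have "(\<lambda>z. (z - c) ^ s * poly q z) \<in> O[at c](\<lambda>z. (z - c) ^ s * 1)"
    by (intro landau_o.big.mult poly_bounded_at) auto
  then show "poly p \<in> O[at c](\<lambda>z. (z - c) ^ s)"
    unfolding p by (subst landau_o.big.in_cong[OF always_eventually]) (auto simp: poly_power)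
next
  assume O: "poly p \<in> O[at c](\<lambda>z. (z - c) ^ s)"
  show "[:-c, 1:] ^ s dvd p"
  proof (rule ccontr)
    assume nd: "\<not> [:-c, 1:] ^ s dvd p"
    then have p: "p \<noteq> 0" by auto
    define k where "k = order c p"
    have k: "k < s" using nd p by (simp add: order_divides k_def)
    obtain q where q: "p = [:-c, 1:] ^ k * q" "\<not> [:-c, 1:] dvd q"
      using order_decomp[OF p, of c] unfolding k_def by blast
    have "(\<lambda>z. (z - c) ^ k * poly q z) \<in> O[at c](\<lambda>z. (z - c) ^ k * (z - c) ^ (s - k))"
    proof -
      have "poly p = (\<lambda>z. (z - c) ^ k * poly q z)" by (auto simp: q(1) poly_power)
      then show ?thesis using O k by (simp add: power_add[symmetric])
    qed
    moreover have ev: "\<forall>\<^sub>F z in at c. (z - c) ^ k \<noteq> 0"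
      using eventually_neq_at_within[of c c UNIV] by (rule eventually_mono) simp
    ultimately have "poly q \<in> O[at c](\<lambda>z. (z - c) ^ (s - k))"
      using landau_o.big.mult_cancel_left[OF bigtheta_refl ev] by blast
    moreover have "(\<lambda>z. (z - c) ^ (s - k)) \<in> o[at c](\<lambda>_. 1 :: complex)"
      using k by (intro smalloI_tendsto) (auto intro!: tendsto_eq_intros)
    ultimately have "(poly q \<longlongrightarrow> 0) (at c)"
      by (blast intro: smalloD_tendsto[where g = "\<lambda>_. 1 :: complex", simplified] landau_o.big_small_trans)
    moreover have "(poly q \<longlongrightarrow> poly q c) (at c)" by (rule poly_tendsto_at)
    ultimately have "poly q c = 0" using tendsto_unique[of "at c"] by (metis at_neq_bot)
    with q(2) show False by (simp add: poly_eq_0_iff_dvd)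
  qed
qed

lemma ratfun_quot:
  "\<phi> = Fract (rat_num \<phi>) (rat_den \<phi>)" "coprime (rat_num \<phi>) (rat_den \<phi>)" "rat_den \<phi> \<noteq> 0"
  unfolding rat_num_def rat_den_def by (simp_all add: coprime_quot_of_fract)

lemma Fract_reduce:
  fixes a b a' b' :: "complex poly"
  assumes "Fract a b = Fract a' b'" "b \<noteq> 0" "b' \<noteq> 0" "coprime a b"
  obtains g where "a' = g * a" "b' = g * b" "g \<noteq> 0"
proof -
  have eq: "a * b' = a' * b" using assms by (simp add: eq_fract)
  then have "b dvd a * b'" by simp
  then have "b dvd b'" using assms(4) by (metis coprime_commute coprime_dvd_mult_right_iff)
  then obtain g where g: "b' = g * b" by (metis dvdE mult.commute)
  with eq assms(2) have "a' = g * a" by (simp add: algebra_simps)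
  then show ?thesis using g assms(3) that by auto
qed

lemma poly_denominator_nonzero:
  fixes a b :: "complex poly"
  assumes "coprime a b" "[:-c, 1:] dvd a - smult v b"
  shows "poly b c \<noteq> 0"
proof
  assume "poly b c = 0"
  then have b: "[:-c, 1:] dvd b" by (simp add: poly_eq_0_iff_dvd)
  then have "[:-c, 1:] dvd a" using assms(2) by (metis dvd_add_left_iff dvd_smult diff_add_cancel)
  with b assms(1) have "is_unit [:-c, 1:]" using coprime_common_divisor by blast
  then show False by (simp add: is_unit_iff_degree)
qed

lemma eventually_poly_nonzero:
  assumes "poly b c \<noteq> 0"
  shows "\<forall>\<^sub>F z in nhds (c :: complex). poly b z \<noteq> 0"
  using tendsto_imp_eventually_ne[OF poly_tendsto_at[unfolded tendsto_at_iff_tendsto_nhds] assms] .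

text \<open>
  Since \<open>b\<close> stays away from \<open>0\<close> near \<open>c\<close>, the error \<open>a / b - c\<close> has the same order as \<open>a - c b\<close>. The
  fixed point condition is implied by divisibility because \<open>s > 0\<close>.
\<close>

lemma order_at_least_Fract:
  assumes b: "poly b c \<noteq> 0" and s: "s > 0"
  shows "order_at_least s (Fract a b) c \<longleftrightarrow> [:-c, 1:] ^ s dvd a - smult c b"
proof -
  have ev: "\<forall>\<^sub>F z in at c. poly b z \<noteq> 0"
    using eventually_poly_nonzero[OF b] by (auto simp: eventually_at_filter elim: eventually_mono)
  have th: "(\<lambda>z. poly (a - smult c b) z / poly b z) \<in> \<Theta>[at c](\<lambda>z. poly (a - smult c b) z / 1)"
  proof (rule landau_theta.divide)
    show "(\<lambda>_. 1) \<in> \<Theta>[at c](poly b)"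
      using tendsto_nonzero_bigtheta_1[OF poly_tendsto_at b] by (simp only: bigtheta_sym)
  qed (use ev in simp_all)
  have "(\<lambda>z. rat_eval (Fract a b) z - c) \<in> O[at c](\<lambda>z. (z - c) ^ s) \<longleftrightarrow>
      (\<lambda>z. poly (a - smult c b) z / poly b z) \<in> O[at c](\<lambda>z. (z - c) ^ s)"
    using ev by (intro landau_o.big.in_cong) (elim eventually_mono, simp add: rat_eval_Fract field_simps)
  also have "(\<lambda>z. poly (a - smult c b) z / poly b z) \<in> O[at c](\<lambda>z. (z - c) ^ s) \<longleftrightarrow>
      (\<lambda>z. poly (a - smult c b) z / 1) \<in> O[at c](\<lambda>z. (z - c) ^ s)"
    by (rule landau_o.big.in_cong_bigtheta[OF th])
  also have "\<dots> \<longleftrightarrow> poly (a - smult c b) \<in> O[at c](\<lambda>z. (z - c) ^ s)"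
    by (simp only: div_by_1)
  also have "\<dots> \<longleftrightarrow> [:-c, 1:] ^ s dvd a - smult c b" by (rule poly_bigo_iff_dvd)
  finally have O: "(\<lambda>z. rat_eval (Fract a b) z - c) \<in> O[at c](\<lambda>z. (z - c) ^ s) \<longleftrightarrow>
      [:-c, 1:] ^ s dvd a - smult c b" .
  have "rat_fixpoint (Fract a b) c" if "[:-c, 1:] ^ s dvd a - smult c b"
  proof -
    have "[:-c, 1:] dvd a - smult c b"
      using that s dvd_trans[OF dvd_power] by blast
    then have "poly a c = c * poly b c" by (simp add: poly_eq_0_iff_dvd[symmetric])
    then show ?thesis using b by (simp add: rat_fixpoint_def rat_eval_Fract)
  qed
  then show ?thesis using O unfolding order_at_least_def by blast
qed

lemma order_exactly_Fract:
  assumes b: "poly b c \<noteq> 0" and s: "s > 0"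
    and dvd: "[:-c, 1:] ^ s dvd a - smult c b" and ndvd: "\<not> [:-c, 1:] ^ Suc s dvd a - smult c b"
  shows "order_exactly s (Fract a b) c"
proof -
  obtain q where q: "a - smult c b = [:-c, 1:] ^ s * q" using dvd by (elim dvdE)
  have qc: "poly q c \<noteq> 0"
  proof
    assume "poly q c = 0"
    then have "[:-c, 1:] dvd q" by (simp add: poly_eq_0_iff_dvd)
    then have "[:-c, 1:] ^ s * [:-c, 1:] dvd a - smult c b" unfolding q by (rule mult_dvd_mono[OF dvd_refl])
    then have "[:-c, 1:] ^ Suc s dvd a - smult c b" by (simp only: power_Suc2)
    with ndvd show False by contradiction
  qed
  define l where "l = cmod (poly q c / poly b c)"
  have l: "l > 0" using b qc by (simp add: l_def)
  have "((\<lambda>z. cmod (poly q z / poly b z)) \<longlongrightarrow> l) (nhds c)"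
    unfolding l_def using b
    by (intro tendsto_intros poly_tendsto_at[unfolded tendsto_at_iff_tendsto_nhds])
  note lim = this
  have "\<forall>\<^sub>F z in nhds c. l / 2 < cmod (poly q z / poly b z)"
    by (rule order_tendstoD(1)[OF lim]) (use l in simp)
  moreover have "\<forall>\<^sub>F z in nhds c. cmod (poly q z / poly b z) < 2 * l"
    by (rule order_tendstoD(2)[OF lim]) (use l in simp)
  ultimately have "\<forall>\<^sub>F z in nhds c. (l / 2) * cmod (z - c) ^ s \<le> cmod (rat_eval (Fract a b) z - c) \<and>
        cmod (rat_eval (Fract a b) z - c) \<le> (2 * l) * cmod (z - c) ^ s"
    using eventually_poly_nonzero[OF b]
  proof eventually_elim
    case (elim z)
    have "poly a z - c * poly b z = (z - c) ^ s * poly q z"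
      using arg_cong[OF q, of "\<lambda>p. poly p z"] by (simp add: poly_power)
    moreover have "rat_eval (Fract a b) z - c = (poly a z - c * poly b z) / poly b z"
      using elim(3) by (simp add: rat_eval_Fract diff_divide_distrib)
    ultimately have norm: "cmod (rat_eval (Fract a b) z - c) = cmod (poly q z / poly b z) * cmod (z - c) ^ s"
      by (simp add: norm_mult norm_power norm_divide)
    show ?case unfolding norm by (intro conjI mult_right_mono less_imp_le elim zero_le_power norm_ge_zero)
  qed
  moreover have "rat_fixpoint (Fract a b) c"
    using order_at_least_Fract[OF b s] dvd unfolding order_at_least_def by blast
  moreover have "l / 2 > 0" "2 * l > 0" using l by simp_all
  ultimately show ?thesis unfolding order_exactly_def by blast
qed

section \<open>Pade approximants of the inverse square root\<close>

text \<open>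
  Near \<open>z = 1\<close> the principal square root of \<open>z\<^sup>2\<close> is \<open>z\<close> itself.
\<close>

lemma inv_sqrt_fun_one_minus_square: "\<forall>\<^sub>F z in nhds 1. inv_sqrt_fun (1 - z ^ 2) = 1 / z"
proof -
  have "\<forall>\<^sub>F z in nhds 1. z \<in> {z. Re z > 0}"
    by (rule eventually_nhds_in_open) (auto simp: open_halfspace_Re_gt)
  then show ?thesis
  proof eventually_elim
    case (elim z)
    then have "csqrt (z ^ 2) = z" by (intro csqrt_square) auto
    with elim show ?case
      by (auto simp: inv_sqrt_fun_def powr_minus_divide csqrt_conv_powr powr_minus field_simps)
  qed
qed

lemma eventually_poly_nonzero_at:
  assumes "b \<noteq> (0 :: complex poly)"
  shows "\<forall>\<^sub>F z in at c. poly b z \<noteq> 0"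
  using islimpt_finite[OF poly_roots_finite[OF assms]] by (auto simp: islimpt_iff_eventually)

text \<open>
  Substituting \<open>\<xi> = 1 - z\<^sup>2\<close> turns \<open>f(\<xi>)\<close> into \<open>1 / z\<close> and \<open>\<xi>\<close> into a simple zero at \<open>z = 1\<close>; multiplying the
  error by \<open>z Q(1 - z\<^sup>2)\<close> gives \<open>Q(1 - z\<^sup>2) - z P(1 - z\<^sup>2)\<close>.
\<close>

lemma pade_imp_dvd:
  assumes "is_pade_approximant inv_sqrt_fun \<mu> \<nu> P Q"
  shows "[:-1, 1:] ^ (\<mu> + \<nu> + 1) dvd [:0, 1:] * (P \<circ>\<^sub>p [:1, 0, -1:]) - Q \<circ>\<^sub>p [:1, 0, -1:]"
proof -
  define s where "s = \<mu> + \<nu> + 1"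
  define a b where "a = [:0, 1:] * (P \<circ>\<^sub>p [:1, 0, -1:])" and "b = Q \<circ>\<^sub>p [:1, 0, -1:]"
  have pade: "Q \<noteq> 0" "(\<lambda>\<xi>. inv_sqrt_fun \<xi> - poly P \<xi> / poly Q \<xi>) \<in> O[at 0](\<lambda>\<xi>. \<xi> ^ s)"
    using assms by (auto simp: is_pade_approximant_def s_def)
  have b: "b \<noteq> 0" using pade(1) by (simp add: b_def pcompose_eq_0_iff)
  have "\<forall>\<^sub>F z in at 1. poly [:1, 0, -1:] z \<noteq> (0 :: complex)"
    by (rule eventually_poly_nonzero_at) simp
  then have "filterlim (\<lambda>z. 1 - z ^ 2) (at 0) (at (1 :: complex))"
    by (intro filterlim_atI) (auto intro!: tendsto_eq_intros simp: power2_eq_square elim: eventually_mono)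
  from landau_o.big.compose[OF pade(2) this]
  have 1: "(\<lambda>z. inv_sqrt_fun (1 - z ^ 2) - poly P (1 - z ^ 2) / poly Q (1 - z ^ 2))
    \<in> O[at 1](\<lambda>z. (1 - z ^ 2) ^ s)" .
  have "[:1, 0, -1 :: complex:] = [:-1, 1:] * [:-1, -1:]" by simp
  then have "[:-1, 1:] ^ s dvd [:1, 0, -1 :: complex:] ^ s" by (metis dvd_power_same dvd_triv_left)
  then have "poly ([:1, 0, -1:] ^ s) \<in> O[at 1](\<lambda>z. (z - 1 :: complex) ^ s)"
    by (simp only: poly_bigo_iff_dvd)
  then have 2: "(\<lambda>z. (1 - z ^ 2) ^ s) \<in> O[at 1](\<lambda>z. (z - 1 :: complex) ^ s)"
    by (subst landau_o.big.in_cong[OF always_eventually]) (auto simp: poly_power power2_eq_square)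
  from landau_o.big.mult[OF poly_bounded_at[of "[:0, 1:] * b" 1] landau_o.big.trans[OF 1 2]]
  have "(\<lambda>z. poly ([:0, 1:] * b) z * (inv_sqrt_fun (1 - z ^ 2) - poly P (1 - z ^ 2) / poly Q (1 - z ^ 2)))
    \<in> O[at 1](\<lambda>z. (z - 1) ^ s)" by simp
  moreover have "\<forall>\<^sub>F z in at 1. poly ([:0, 1:] * b) z * (inv_sqrt_fun (1 - z ^ 2) - poly P (1 - z ^ 2) / poly Q (1 - z ^ 2))
     = poly (b - a) z"
  proof -
    have "\<forall>\<^sub>F z in at 1. inv_sqrt_fun (1 - z ^ 2) = 1 / z"
      using inv_sqrt_fun_one_minus_square by (auto simp: eventually_at_filter elim: eventually_mono)
    moreover have "\<forall>\<^sub>F z in at 1. poly ([:0, 1:] * b) z \<noteq> 0"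
      using b by (intro eventually_poly_nonzero_at) simp
    ultimately show ?thesis
    proof eventually_elim
      case (elim z)
      have "poly b z = poly Q (1 - z ^ 2)" "poly a z = z * poly P (1 - z ^ 2)"
        by (simp_all add: a_def b_def poly_pcompose power2_eq_square)
      with elim show ?case by (simp add: field_simps)
    qed
  qed
  ultimately have "poly (b - a) \<in> O[at 1](\<lambda>z. (z - 1) ^ s)"
    by (rule iffD1[OF landau_o.big.in_cong, rotated])
  then have "[:-1, 1:] ^ s dvd b - a" by (simp only: poly_bigo_iff_dvd)
  then show ?thesis unfolding s_def a_def b_def by (metis dvd_minus_iff minus_diff_eq)
qed

text \<open>
  The inverse substitution is \<open>z = sqrt(1 - \<xi>)\<close>, for which \<open>z - 1 = - \<xi> / (z + 1)\<close>. Hence the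
  factor \<open>(z - 1)\<^sup>s\<close> of \<open>z P - Q\<close> produces \<open>\<xi>\<^sup>s\<close> times a function that is bounded near \<open>0\<close>,
  called \<open>H\<close> below.
\<close>

lemma dvd_imp_pade:
  assumes "degree P = \<mu>" "degree Q = \<nu>" "poly Q 0 \<noteq> 0"
    and "[:-1, 1:] ^ (\<mu> + \<nu> + 1) dvd [:0, 1:] * (P \<circ>\<^sub>p [:1, 0, -1:]) - Q \<circ>\<^sub>p [:1, 0, -1:]"
  shows "is_pade_approximant inv_sqrt_fun \<mu> \<nu> P Q"
proof -
  define s where "s = \<mu> + \<nu> + 1"
  obtain g where g: "[:0, 1:] * (P \<circ>\<^sub>p [:1, 0, -1:]) - Q \<circ>\<^sub>p [:1, 0, -1:] = [:-1, 1:] ^ s * g"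
    using assms(4) unfolding s_def by (elim dvdE)
  have id: "w * poly P (1 - w ^ 2) - poly Q (1 - w ^ 2) = (w - 1) ^ s * poly g w" for w
    using arg_cong[OF g, of "\<lambda>p. poly p w"] by (simp add: poly_pcompose poly_power power2_eq_square)
  define w where "w = (\<lambda>\<xi> :: complex. csqrt (1 - \<xi>))"
  define H where "H = (\<lambda>\<xi>. - ((- 1 / (w \<xi> + 1)) ^ s * poly g (w \<xi>)) / (w \<xi> * poly Q \<xi>))"
  have w_lim: "(w \<longlongrightarrow> 1) (at 0)"
  proof -
    have "isCont w 0" unfolding w_def by (intro isCont_csqrt' continuous_intros) auto
    then show ?thesis by (simp add: isCont_def w_def)
  qed
  have "((\<lambda>\<xi>. poly g (w \<xi>)) \<longlongrightarrow> poly g 1) (at 0)"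
    using isCont_tendsto_compose[OF DERIV_isCont[OF poly_DERIV] w_lim] .
  then have "(H \<longlongrightarrow> - ((- 1 / (1 + 1)) ^ s * poly g 1) / (1 * poly Q 0)) (at 0)"
    unfolding H_def using assms(3) w_lim poly_tendsto_at[of Q 0]
    by (intro tendsto_intros) auto
  then have "H \<in> O[at 0](\<lambda>_. 1)"
    by (intro bigoI_tendsto[of _ _ "- ((- 1 / (1 + 1)) ^ s * poly g 1) / (1 * poly Q 0)"]) auto
  then have "(\<lambda>\<xi>. \<xi> ^ s * H \<xi>) \<in> O[at 0](\<lambda>\<xi>. \<xi> ^ s * 1)"
    by (intro landau_o.big.mult) auto
  then have O: "(\<lambda>\<xi>. \<xi> ^ s * H \<xi>) \<in> O[at 0](\<lambda>\<xi>. \<xi> ^ s)" by simp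
  have Q: "Q \<noteq> 0" using assms(3) by auto
  have frac: "- (x * p - y) / (x * y) = 1 / x - p / y" if "x \<noteq> 0" "y \<noteq> 0" for x y p :: complex
    using that by (simp add: field_simps)
  have "\<forall>\<^sub>F \<xi> in at 0. w \<xi> \<noteq> 0" "\<forall>\<^sub>F \<xi> in at 0. w \<xi> \<noteq> -1"
    by (auto intro!: tendsto_imp_eventually_ne[OF w_lim])
  then have "\<forall>\<^sub>F \<xi> in at 0. \<xi> ^ s * H \<xi> = inv_sqrt_fun \<xi> - poly P \<xi> / poly Q \<xi>"
    using eventually_poly_nonzero_at[OF Q, of 0]
  proof eventually_elim
    case (elim \<xi>)
    have sq: "w \<xi> ^ 2 = 1 - \<xi>" by (simp add: w_def)
    then have xi: "1 - w \<xi> ^ 2 = \<xi>" by simp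
    have f: "inv_sqrt_fun \<xi> = 1 / w \<xi>"
      by (simp add: inv_sqrt_fun_def w_def csqrt_conv_powr powr_minus_divide)
    have w1: "w \<xi> + 1 \<noteq> 0" using elim(2) by (metis eq_neg_iff_add_eq_0)
    have "(w \<xi> - 1) * (w \<xi> + 1) = - \<xi>" using sq by (simp add: algebra_simps power2_eq_square)
    then have "w \<xi> - 1 = \<xi> * (- 1 / (w \<xi> + 1))" using w1 by (simp add: field_simps)
    then have "(w \<xi> - 1) ^ s = \<xi> ^ s * (- 1 / (w \<xi> + 1)) ^ s" by (simp only: power_mult_distrib)
    then have "\<xi> ^ s * H \<xi> = - ((w \<xi> - 1) ^ s * poly g (w \<xi>)) / (w \<xi> * poly Q \<xi>)"
      by (simp add: H_def mult.assoc)
    also have "\<dots> = - (w \<xi> * poly P \<xi> - poly Q \<xi>) / (w \<xi> * poly Q \<xi>)"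
      using id[of "w \<xi>"] by (simp only: xi)
    also have "\<dots> = inv_sqrt_fun \<xi> - poly P \<xi> / poly Q \<xi>"
      unfolding f using frac[OF elim(1,3)] .
    finally show ?case .
  qed
  with O have "(\<lambda>\<xi>. inv_sqrt_fun \<xi> - poly P \<xi> / poly Q \<xi>) \<in> O[at 0](\<lambda>\<xi>. \<xi> ^ s)"
    by (rule iffD1[OF landau_o.big.in_cong, rotated])
  then show ?thesis using assms(1,2) Q by (simp add: is_pade_approximant_def s_def)
qed

section \<open>The Pade iterations as solutions of the contact problem\<close>

text \<open>
  Conjugation by the reflection \<open>z \<mapsto> -z\<close> exchanges the conditions at \<open>1\<close> and \<open>-1\<close>.
\<close>

lemma sign_contact_reflect:
  assumes "sign_contact i j a b"
  shows "sign_contact j i (- (a \<circ>\<^sub>p [:0, -1:])) (b \<circ>\<^sub>p [:0, -1:])"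
proof -
  have reflect: "[:- c, 1:] ^ n dvd q \<circ>\<^sub>p [:0, -1:]" if "[:c, 1:] ^ n dvd q" for c :: complex and n q
  proof -
    obtain r where "q = [:c, 1:] ^ n * r" using \<open>[:c, 1:] ^ n dvd q\<close> by (elim dvdE)
    moreover have "([:c, 1:] ^ n) \<circ>\<^sub>p [:0, -1:] = [:c, -1:] ^ n"
    proof (induction n)
      case (Suc n)
      have "[:c, 1:] \<circ>\<^sub>p [:0, -1:] = [:c, -1:]" by (simp add: pcompose_pCons)
      then show ?case by (simp only: power_Suc pcompose_mult Suc.IH)
    qed (simp add: pcompose_1)
    ultimately have "q \<circ>\<^sub>p [:0, -1:] = [:c, -1:] ^ n * (r \<circ>\<^sub>p [:0, -1:])"
      by (simp only: pcompose_mult)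
    moreover have "[:c, -1:] = [:-1:] * [:- c, 1:]" by simp
    ultimately have "q \<circ>\<^sub>p [:0, -1:] = [:- c, 1:] ^ n * ([:-1:] ^ n * (r \<circ>\<^sub>p [:0, -1:]))"
      by (simp only: power_mult_distrib mult_ac)
    then show ?thesis by (metis dvd_triv_left)
  qed
  have "[:-1, 1:] ^ j dvd (a + b) \<circ>\<^sub>p [:0, -1:]" "[:1, 1:] ^ i dvd (a - b) \<circ>\<^sub>p [:0, -1:]"
    using assms reflect[of 1 j "a + b"] reflect[of "-1" i "a - b"]
    by (simp_all add: sign_contact_def)
  moreover have "- (a \<circ>\<^sub>p [:0, -1:]) - b \<circ>\<^sub>p [:0, -1:] = - ((a + b) \<circ>\<^sub>p [:0, -1:])"
    "- (a \<circ>\<^sub>p [:0, -1:]) + b \<circ>\<^sub>p [:0, -1:] = - ((a - b) \<circ>\<^sub>p [:0, -1:])"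
    by (simp_all add: pcompose_add pcompose_diff)
  ultimately show ?thesis by (simp add: sign_contact_def)
qed

lemma sign_contact_denominator:
  assumes "coprime a b" "sign_contact i j a b" "i > 0" "j > 0"
  shows "poly b 1 \<noteq> 0" "poly b (-1) \<noteq> 0"
proof -
  have "[:-1, 1:] dvd a - smult 1 b" "[:-(-1), 1:] dvd a - smult (-1) b"
    using assms(2) dvd_trans[OF dvd_power] assms(3,4) unfolding sign_contact_def by auto
  from this[THEN poly_denominator_nonzero[OF assms(1)]]
  show "poly b 1 \<noteq> 0" "poly b (-1) \<noteq> 0" by blast+
qed

text \<open>
  The reflected pair solves the same contact problem in the same degrees, so by uniqueness it
  represents the same rational function: \<open>a / b\<close> is odd. In lowest terms this makes \<open>b\<close> even or
  odd, according to the parity of its degree.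
\<close>

lemma sign_contact_parity:
  assumes "sign_contact s s a b" "degree a + degree b + 1 = 2 * s" "b \<noteq> 0" "even (degree b)"
  shows "b \<circ>\<^sub>p [:0, -1:] = b" "a \<circ>\<^sub>p [:0, -1:] = - a"
proof -
  have cop: "coprime a b" using sign_contact_small_degree[OF assms(1)] assms(2,3) by simp
  define b' where "b' = b \<circ>\<^sub>p [:0, -1:]"
  have deg: "degree b' = degree b" by (simp add: b'_def degree_pcompose)
  have b': "b' \<noteq> 0" using assms(3) by (simp add: b'_def pcompose_eq_0_iff)
  have lc: "lead_coeff b' = lead_coeff b"
    using assms(4) by (simp add: b'_def lead_coeff_comp)
  have eq: "a * b' = - (a \<circ>\<^sub>p [:0, -1:]) * b"
    unfolding b'_def using assms(2)
    by (intro sign_contact_unique[OF assms(1) sign_contact_reflect[OF assms(1)], of "degree a" "degree b"])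
      (auto simp: degree_pcompose)
  then have "b dvd a * b'" by simp
  then have "b dvd b'" using cop by (metis coprime_commute coprime_dvd_mult_right_iff)
  then obtain k where k: "b' = b * k" by (elim dvdE)
  with b' have nz: "k \<noteq> 0" by auto
  then have "degree k = 0" using deg k assms(3) by (simp add: degree_mult_eq)
  then obtain x where x: "k = [:x:]" by (meson degree_eq_zeroE)
  have "lead_coeff b * x = lead_coeff b" using lc unfolding k x lead_coeff_mult by simp
  then have "x = 1" using assms(3) by simp
  then have "b' = b" using k x by simp
  then show "b \<circ>\<^sub>p [:0, -1:] = b" by (simp add: b'_def)
  have "a * b = - (a \<circ>\<^sub>p [:0, -1:]) * b" using eq by (simp only: \<open>b' = b\<close>)
  then have "a = - (a \<circ>\<^sub>p [:0, -1:])" using assms(3) by (simp only: mult_cancel_right) simp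
  then show "a \<circ>\<^sub>p [:0, -1:] = - a" by (metis minus_minus)
qed

lemma degree_pcompose_one_minus_square:
  "degree (p \<circ>\<^sub>p [:1, 0, -1 :: complex:]) = 2 * degree p"
  by (simp add: degree_pcompose)

text \<open>
  The Pade approximant of type \<open>(\<mu>, \<nu>)\<close>, with exact degrees, is read off from the solution of the
  contact problem in degrees \<open>2 \<mu> + 1\<close> and \<open>2 \<nu>\<close>: its numerator is odd and its denominator
  even, so they have the form \<open>z P(1 - z\<^sup>2)\<close> and \<open>Q(1 - z\<^sup>2)\<close>.
\<close>

lemma pade_exists: "\<exists>P Q. is_pade_approximant inv_sqrt_fun \<mu> \<nu> P Q"
proof -
  define s where "s = \<mu> + \<nu> + 1"
  have "(2 * \<mu> + 1) + 2 * \<nu> + 1 = 2 * s" by (simp add: s_def)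
  then obtain a b where ab: "sign_contact s s a b" "degree a = 2 * \<mu> + 1" "degree b = 2 * \<nu>" "b \<noteq> 0"
    by (rule sign_contact_exists)
  have sum: "degree a + degree b + 1 = 2 * s" using ab by (simp add: s_def)
  have parity: "b \<circ>\<^sub>p [:0, -1:] = b" "a \<circ>\<^sub>p [:0, -1:] = - a"
    using sign_contact_parity[OF ab(1) sum ab(4)] ab(3) by auto
  obtain Q where Q: "b = Q \<circ>\<^sub>p [:1, 0, -1:]" using even_poly_pcompose[OF parity(1)] .
  have "poly a 0 = - poly a 0" using arg_cong[OF parity(2), of "\<lambda>p. poly p 0"] by (simp add: poly_pcompose)
  then have "[:-0, 1:] dvd a" by (simp only: poly_eq_0_iff_dvd[symmetric] equation_minus_iff[symmetric]) simp
  then obtain e where e: "a = [:0, 1:] * e" by (metis dvdE minus_zero)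
  have "[:0, -1:] * (e \<circ>\<^sub>p [:0, -1:]) = a \<circ>\<^sub>p [:0, -1:]"
    unfolding e by (simp add: pcompose_mult pcompose_pCons)
  also have "\<dots> = [:0, -1:] * e" by (simp only: parity(2)) (simp add: e)
  finally have "e \<circ>\<^sub>p [:0, -1:] = e" by (simp only: mult_cancel_left) auto
  from even_poly_pcompose[OF this] obtain P where P: "e = P \<circ>\<^sub>p [:1, 0, -1:]" .
  have "e \<noteq> 0" using e ab(2) by auto
  then have "degree a = 1 + degree e" unfolding e by (subst degree_mult_eq) auto
  then have "degree P = \<mu>" "degree Q = \<nu>"
    using ab(2,3) by (simp_all add: P Q degree_pcompose_one_minus_square)
  moreover have "poly Q 0 \<noteq> 0"
    using sign_contact_denominator(1)[of a b s s] sign_contact_small_degree[OF ab(1)] ab(1,4) sum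
    by (simp add: Q poly_pcompose s_def)
  moreover have "[:-1, 1:] ^ (\<mu> + \<nu> + 1) dvd [:0, 1:] * (P \<circ>\<^sub>p [:1, 0, -1:]) - Q \<circ>\<^sub>p [:1, 0, -1:]"
    using ab(1) unfolding sign_contact_def s_def e P Q by blast
  ultimately have "is_pade_approximant inv_sqrt_fun \<mu> \<nu> P Q" by (rule dvd_imp_pade)
  then show ?thesis by blast
qed

lemma pade_pair_is_pade: "is_pade_approximant inv_sqrt_fun \<mu> \<nu> (pade_P \<mu> \<nu>) (pade_Q \<mu> \<nu>)"
proof -
  obtain P Q where "is_pade_approximant inv_sqrt_fun \<mu> \<nu> P Q" using pade_exists by blast
  then have "(\<lambda>(p, q). is_pade_approximant inv_sqrt_fun \<mu> \<nu> p q) (P, Q)" by simp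
  then have "(\<lambda>(p, q). is_pade_approximant inv_sqrt_fun \<mu> \<nu> p q) (pade_pair \<mu> \<nu>)"
    unfolding pade_pair_def by (rule someI)
  then show ?thesis by (simp add: pade_P_def pade_Q_def case_prod_unfold)
qed

text \<open>
  Pade approximation gives the contact at \<open>1\<close>, and the contact at \<open>-1\<close> follows by reflection since
  \<open>a\<close> is odd and \<open>b\<close> is even.
\<close>

lemma pade_sign_contact:
  fixes \<mu> \<nu> :: nat
  defines "a \<equiv> [:0, 1:] * (pade_P \<mu> \<nu> \<circ>\<^sub>p [:1, 0, -1:])" and "b \<equiv> pade_Q \<mu> \<nu> \<circ>\<^sub>p [:1, 0, -1:]"
  shows "sign_contact (\<mu> + \<nu> + 1) (\<mu> + \<nu> + 1) a b" "degree a = 2 * \<mu> + 1" "degree b = 2 * \<nu>"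
    "a \<noteq> 0" "b \<noteq> 0"
proof -
  let ?s = "\<mu> + \<nu> + 1"
  note pade = pade_pair_is_pade[of \<mu> \<nu>]
  have deg: "degree (pade_P \<mu> \<nu>) = \<mu>" "degree (pade_Q \<mu> \<nu>) = \<nu>" "pade_Q \<mu> \<nu> \<noteq> 0"
    using pade by (auto simp: is_pade_approximant_def)
  show b: "b \<noteq> 0" using deg by (simp add: b_def pcompose_eq_0_iff)
  show degb: "degree b = 2 * \<nu>" using deg by (simp add: b_def degree_pcompose_one_minus_square)
  have "[:1, 0, -1:] \<circ>\<^sub>p [:0, -1:] = [:1, 0, -1 :: complex:]" by (simp add: pcompose_pCons)
  then have par: "b \<circ>\<^sub>p [:0, -1:] = b" "a \<circ>\<^sub>p [:0, -1:] = - a"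
    by (simp_all add: a_def b_def pcompose_mult pcompose_assoc[symmetric] pcompose_pCons)
  have d1: "[:-1, 1:] ^ ?s dvd a - b" unfolding a_def b_def by (rule pade_imp_dvd[OF pade])
  then have "sign_contact ?s 0 a b" by (simp add: sign_contact_def)
  from sign_contact_reflect[OF this] have "[:1, 1:] ^ ?s dvd a + b"
    by (simp add: sign_contact_def par)
  with d1 show con: "sign_contact ?s ?s a b" by (simp add: sign_contact_def)
  show a: "a \<noteq> 0"
  proof
    assume "a = 0"
    with sign_contact_nonzero[OF con] b degb show False by simp
  qed
  then have "pade_P \<mu> \<nu> \<circ>\<^sub>p [:1, 0, -1:] \<noteq> 0" unfolding a_def by auto
  then have "degree a = 1 + degree (pade_P \<mu> \<nu> \<circ>\<^sub>p [:1, 0, -1:])"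
    unfolding a_def by (subst degree_mult_eq) auto
  then show "degree a = 2 * \<mu> + 1" using deg by (simp add: degree_pcompose_one_minus_square)
qed

lemma pade_phi_sign_contact:
  assumes "m + n + 1 = 2 * s"
  obtains a b where "pade_phi m n = Fract a b" "sign_contact s s a b" "degree a = m" "degree b = n" "b \<noteq> 0"
proof (cases "odd m")
  case True
  then have "odd m \<and> even n" "m = 2 * (m div 2) + 1" "n = 2 * (n div 2)" "s = m div 2 + n div 2 + 1"
    using assms by presburger+
  then show ?thesis
    using that pade_sign_contact[of "m div 2" "n div 2"]
    by (simp add: pade_phi_def pade_iteration_def)
next
  case False
  then have "even m \<and> odd n" "n = 2 * (n div 2) + 1" "m = 2 * (m div 2)" "s = n div 2 + m div 2 + 1"
    using assms by presburger+
  then show ?thesis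
    using that pade_sign_contact[of "n div 2" "m div 2"] sign_contact_commute
    by (simp add: pade_phi_def recip_pade_iteration_def)
qed

section \<open>Characterisation of the iterations\<close>

lemma locally_convergent_iff_sign_contact:
  assumes "coprime a b" "b \<noteq> 0" "s > 0"
  shows "locally_convergent_to_signs s (Fract a b) \<longleftrightarrow> sign_contact s s a b"
proof -
  have iff: "locally_convergent_to_signs s (Fract a b) \<longleftrightarrow> sign_contact s s a b"
    if "poly b 1 \<noteq> 0" "poly b (-1) \<noteq> 0"
    using order_at_least_Fract[OF that(1) assms(3), of a] order_at_least_Fract[OF that(2) assms(3), of a]
    by (simp add: locally_convergent_to_signs_def sign_contact_def)
  have "poly b 1 \<noteq> 0 \<and> poly b (-1) \<noteq> 0" if "locally_convergent_to_signs s (Fract a b)"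
  proof -
    obtain g where g: "rat_den (Fract a b) = g * b"
      using Fract_reduce[OF ratfun_quot(1)[of "Fract a b"] assms(2) ratfun_quot(3) assms(1)] by blast
    have "rat_finite_at (Fract a b) 1" "rat_finite_at (Fract a b) (-1)"
      using that by (auto simp: locally_convergent_to_signs_def order_at_least_def rat_fixpoint_def)
    then show ?thesis unfolding rat_finite_at_def g by auto
  qed
  then show ?thesis using iff sign_contact_denominator[OF assms(1) _ assms(3,3)] by blast
qed

text \<open>
  Competitors need not be in lowest terms, but passing to lowest terms only lowers the degrees. For
  this the numerator must not be zero, as \<open>degree 0 = 0\<close> would otherwise hide a cancelled factor.
\<close>

lemma locally_convergent_degree_bound:
  assumes "locally_convergent_to_signs s (Fract a b)" "b \<noteq> 0" "s > 0"
  shows "2 * s \<le> degree a + degree b + 1"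
proof -
  define a1 b1 where "a1 = rat_num (Fract a b)" and "b1 = rat_den (Fract a b)"
  have ab1: "Fract a b = Fract a1 b1" "coprime a1 b1" "b1 \<noteq> 0"
    using ratfun_quot[of "Fract a b"] by (simp_all add: a1_def b1_def)
  obtain g where g: "a = g * a1" "b = g * b1" "g \<noteq> 0"
    using Fract_reduce[OF ab1(1)[symmetric] ab1(3) assms(2) ab1(2)] .
  have con: "sign_contact s s a1 b1"
    using assms(1,3) ab1 locally_convergent_iff_sign_contact by simp
  have "2 * s \<le> degree a1 + degree b1 + 1"
    using sign_contact_degree_bound[OF ab1(2) con] assms(3) by simp
  moreover have "a1 \<noteq> 0"
  proof
    assume "a1 = 0"
    then have "is_unit b1" using ab1(2) by simp
    then have "degree b1 = 0" by (simp add: is_unit_iff_degree ab1(3))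
    with sign_contact_nonzero[OF con] ab1(3) assms(3) \<open>a1 = 0\<close> show False by simp
  qed
  ultimately show ?thesis using g ab1(3) by (simp add: degree_mult_eq)
qed

text \<open>
  One more order of contact at either point would raise the degree bound to \<open>2 s\<close>.
\<close>

lemma sign_contact_order_exactly:
  assumes "sign_contact s s a b" "degree a + degree b + 1 = 2 * s" "b \<noteq> 0" "s > 0"
  shows "order_exactly s (Fract a b) 1" "order_exactly s (Fract a b) (-1)"
proof -
  have cop: "coprime a b" using sign_contact_small_degree[OF assms(1)] assms by simp
  have no: "\<not> sign_contact (Suc s) s a b" "\<not> sign_contact s (Suc s) a b"
    using sign_contact_degree_bound[OF cop] assms(2,4) by fastforce+
  note nz = sign_contact_denominator[OF cop assms(1,4,4)]
  show "order_exactly s (Fract a b) 1"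
    using assms(1) no(1) by (intro order_exactly_Fract nz assms) (simp_all add: sign_contact_def del: power_Suc)
  show "order_exactly s (Fract a b) (-1)"
    using assms(1) no(2) by (intro order_exactly_Fract nz assms) (simp_all add: sign_contact_def del: power_Suc)
qed

theorem theorem1:
  fixes s :: nat
  assumes "s > 1"
  shows "(\<forall>\<phi> :: complex poly fract.
            (locally_convergent_to_signs s \<phi> \<and> minimal_total_degree s \<phi>) \<longleftrightarrow>
            (\<exists>m \<in> {0..2 * s - 1}. \<phi> = pade_phi m (2 * s - m - 1))) \<and>
         (\<forall>m \<in> {0..2 * s - 1}.
            order_exactly s (pade_phi m (2 * s - m - 1)) 1 \<and>
            order_exactly s (pade_phi m (2 * s - m - 1)) (-1))"
proof (intro conjI allI ballI iffI)
  have s: "s > 0" using assms by simp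
  fix m assume "m \<in> {0..2 * s - 1}"
  then have "m + (2 * s - m - 1) + 1 = 2 * s" using s by auto
  then obtain a b where ab: "pade_phi m (2 * s - m - 1) = Fract a b" "sign_contact s s a b"
    "degree a = m" "degree b = 2 * s - m - 1" "b \<noteq> 0" by (rule pade_phi_sign_contact)
  have "degree a + degree b + 1 = 2 * s" using \<open>m + (2 * s - m - 1) + 1 = 2 * s\<close> ab(3,4) by simp
  from sign_contact_order_exactly[OF ab(2) this ab(5) s]
  show "order_exactly s (pade_phi m (2 * s - m - 1)) 1"
    "order_exactly s (pade_phi m (2 * s - m - 1)) (-1)" by (simp_all only: ab(1))
next
  have s: "s > 0" using assms by simp
  fix \<phi> assume "\<exists>m \<in> {0..2 * s - 1}. \<phi> = pade_phi m (2 * s - m - 1)"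
  then obtain m where m: "m \<le> 2 * s - 1" "\<phi> = pade_phi m (2 * s - m - 1)" by auto
  then have sum: "m + (2 * s - m - 1) + 1 = 2 * s" using s by auto
  then obtain a b where ab: "\<phi> = Fract a b" "sign_contact s s a b"
    "degree a = m" "degree b = 2 * s - m - 1" "b \<noteq> 0" unfolding m(2) by (rule pade_phi_sign_contact)
  have deg: "degree a + degree b + 1 = 2 * s" using sum ab(3,4) by simp
  have cop: "coprime a b" using sign_contact_small_degree[OF ab(2)] ab(5) deg by simp
  show "locally_convergent_to_signs s \<phi>"
    using locally_convergent_iff_sign_contact[OF cop ab(5) s] ab(1,2) by simp
  show "minimal_total_degree s \<phi>"
    unfolding minimal_total_degree_def
  proof (intro exI conjI allI impI)
    show "b \<noteq> 0" "coprime a b" "\<phi> = Fract a b" by fact+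
    fix a' b' :: "complex poly"
    assume "b' \<noteq> 0" "order_at_least s (Fract a' b') 1" "order_at_least s (Fract a' b') (-1)"
    then have "2 * s \<le> degree a' + degree b' + 1"
      using locally_convergent_degree_bound s by (simp add: locally_convergent_to_signs_def)
    with deg show "degree a + degree b \<le> degree a' + degree b'" by simp
  qed
next
  have s: "s > 0" using assms by simp
  fix \<phi> assume "locally_convergent_to_signs s \<phi> \<and> minimal_total_degree s \<phi>"
  then have conv: "locally_convergent_to_signs s \<phi>" and "minimal_total_degree s \<phi>" by auto
  then obtain a b where ab: "b \<noteq> 0" "coprime a b" "\<phi> = Fract a b"
    and min: "\<And>a' b'. b' \<noteq> 0 \<Longrightarrow> locally_convergent_to_signs s (Fract a' b') \<Longrightarrow>
      degree a + degree b \<le> degree a' + degree b'"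
    unfolding minimal_total_degree_def locally_convergent_to_signs_def by metis
  have con: "sign_contact s s a b" using conv locally_convergent_iff_sign_contact[OF ab(2,1) s] ab(3) by simp
  have "degree a + degree b + 1 = 2 * s"
  proof (rule antisym)
    \<comment> \<open>Any solution of total degree \<open>2 s - 1\<close> serves as competitor; the Hermite interpolant is one.\<close>
    have "(2 * s - 1) + 0 + 1 = 2 * s" using s by simp
    then obtain c d where cd: "sign_contact s s c d" "degree c = 2 * s - 1" "degree d = 0" "d \<noteq> 0"
      by (rule sign_contact_exists)
    then have "coprime c d" using sign_contact_small_degree[OF cd(1)] s by simp
    then have "locally_convergent_to_signs s (Fract c d)"
      using locally_convergent_iff_sign_contact cd s by simp
    then have "degree a + degree b \<le> degree c + degree d" by (rule min[OF cd(4)])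
    then show "degree a + degree b + 1 \<le> 2 * s" using cd(2,3) s by simp
    show "2 * s \<le> degree a + degree b + 1"
      using locally_convergent_degree_bound conv ab s by simp
  qed
  note deg = this
  then have n: "degree b = 2 * s - degree a - 1" by simp
  obtain c d where cd: "pade_phi (degree a) (degree b) = Fract c d" "sign_contact s s c d"
    "degree c = degree a" "degree d = degree b" "d \<noteq> 0" using pade_phi_sign_contact[OF deg] .
  have "a * d = c * b"
    using sign_contact_unique[OF con cd(2), of "degree a" "degree b"] cd(3,4) deg by simp
  then have "\<phi> = pade_phi (degree a) (degree b)"
    unfolding ab(3) cd(1) using ab(1) cd(5) by (simp add: eq_fract)
  with n deg show "\<exists>m \<in> {0..2 * s - 1}. \<phi> = pade_phi m (2 * s - m - 1)"
    by (intro bexI[of _ "degree a"]) auto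
qed

end
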